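(* The linear Korteweg operator $\mathcal L:=-A^1\partial_x+B\partial_x^2+C\partial_x^3$, associated with the system $A^0W_t=\mathcal LW$ of the context, satisfies the genuine coupling condition; that is, the triplet $(A^0,A(\xi),B(\xi))$ with $A(\xi)=A^1+\xi^2C$ and $B(\xi)=\xi^2B$ is genuinely coupled.
   Context: $\overline\rho,\overline\theta,\overline p_\rho,\overline p_\theta,\overline e_\theta,\overline\mu,\overline\alpha,\overline k>0$ and $\overline u\in\mathbb R$ are constants (a constant state $(\overline\rho,\overline u,\overline\theta)$ and the values at it of derivatives of the pressure $p$ and internal energy $e$, the viscosity, heat conductivity and capillarity), and $$A^0=\frac1{\overline\theta}\begin{pmatrix}\overline p_\rho/\overline\rho&0&0\\0&\overline\rho&0\\0&0&\overline e_\theta\overline\rho/\overline\theta\end{pmatrix},\quad A^1=\frac1{\overline\theta}\begin{pmatrix}\overline p_\rho\overline u/\overline\rho&\overline p_\rho&0\\\overline p_\rho&\overline\rho\,\overline u&\overline p_\theta\\0&\overline p_\theta&\overline\rho\,\overline u\,\overline e_\theta/\overline\theta\end{pmatrix},$$ $$B=\frac1{\overline\theta}\begin{pmatrix}0&0&0\\0&\overline\mu&0\\0&0&\overline\alpha/\overline\theta\end{pmatrix},\quad C=\frac1{\overline\theta}\begin{pmatrix}0&0&0\\\overline k\,\overline\rho&0&0\\0&0&0\end{pmatrix}.$$ A triplet $(A^0,A,B)(\xi)$ of matrix symbols is *genuinely coupled* if for all $\xi\ne0$ every vector $V\in\ker B(\xi)$, $V\ne0$, satisfies $(\varrho A^0(\xi)+A(\xi))V\ne0$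 for any $\varrho\in\mathbb R$; in that case the corresponding operator $\mathcal L$ is said to satisfy the genuine coupling condition. *)

theory Defs
  imports "HOL-Analysis.Analysis"
begin

definition complexify :: "real^'n^'m \<Rightarrow> complex^'n^'m" where
  "complexify M = (\<chi> i j. complex_of_real (M $ i $ j))"

(* The symbols are real matrices; they act on complex vectors, the values of Fourier
   transforms. This includes the case of real vectors V. *)
definition genuinely_coupled ::
    "(real \<Rightarrow> real^'n^'n) \<Rightarrow> (real \<Rightarrow> real^'n^'n) \<Rightarrow> (real \<Rightarrow> real^'n^'n) \<Rightarrow> bool" where
  "genuinely_coupled A0 A B \<longleftrightarrow>
     (\<forall>\<xi>. \<xi> \<noteq> 0 \<longrightarrow>
       (\<forall>V :: complex^'n. complexify (B \<xi>) *v V = 0 \<and> V \<noteq> 0 \<longrightarrow>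
         (\<forall>\<rho>::real. complexify (\<rho> *\<^sub>R A0 \<xi> + A \<xi>) *v V \<noteq> 0)))"

(* L acts on plane waves exp(i xi x) V as multiplication by -(i xi A(xi) + B(xi)).
   Since A and B are real, L determines B(xi) for every xi and A(xi) for every xi other than 0. *)
definition has_symbols ::
    "((real \<Rightarrow> complex^'n) \<Rightarrow> real \<Rightarrow> complex^'n) \<Rightarrow>
     (real \<Rightarrow> real^'n^'n) \<Rightarrow> (real \<Rightarrow> real^'n^'n) \<Rightarrow> bool" where
  "has_symbols L A B \<longleftrightarrow>
     (\<forall>\<xi> V x.
        L (\<lambda>y. exp (\<i> * of_real (\<xi> * y)) *s V) x =
          exp (\<i> * of_real (\<xi> * x)) *s
            (- ((\<i> * of_real \<xi>) *s (complexify (A \<xi>) *v V) + complexify (B \<xi>) *v V)))"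

definition genuine_coupling_condition ::
    "(real \<Rightarrow> real^'n^'n) \<Rightarrow> ((real \<Rightarrow> complex^'n) \<Rightarrow> real \<Rightarrow> complex^'n) \<Rightarrow> bool" where
  "genuine_coupling_condition A0 L \<longleftrightarrow>
     (\<exists>A B. has_symbols L A B \<and> genuinely_coupled A0 A B)"

definition d_x :: "(real \<Rightarrow> complex^'n) \<Rightarrow> real \<Rightarrow> complex^'n" where
  "d_x W = (\<lambda>x. vector_derivative W (at x))"

definition korteweg_operator ::
    "real^'n^'n \<Rightarrow> real^'n^'n \<Rightarrow> real^'n^'n \<Rightarrow>
     (real \<Rightarrow> complex^'n) \<Rightarrow> real \<Rightarrow> complex^'n" where
  "korteweg_operator A1 B C W =
     (\<lambda>x. - (complexify A1 *v d_x W x)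
          + complexify B *v (d_x ^^ 2) W x
          + complexify C *v (d_x ^^ 3) W x)"

(* The parameters r, u, th, p_r, p_th, e_th, mu, al, k are the density, velocity, temperature,
   derivatives of the pressure, temperature derivative of the internal energy, viscosity, heat
   conductivity and capillarity at the constant state. *)

definition korteweg_A0 :: "real \<Rightarrow> real \<Rightarrow> real \<Rightarrow> real \<Rightarrow> real^3^3" where
  "korteweg_A0 r th p_r e_th = (1 / th) *\<^sub>R
     vector [vector [p_r / r, 0, 0],
             vector [0,       r, 0],
             vector [0,       0, e_th * r / th]]"

definition korteweg_A1 ::
    "real \<Rightarrow> real \<Rightarrow> real \<Rightarrow> real \<Rightarrow> real \<Rightarrow> real \<Rightarrow> real^3^3" where
  "korteweg_A1 r u th p_r p_th e_th = (1 / th) *\<^sub>R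
     vector [vector [p_r * u / r, p_r,   0],
             vector [p_r,         r * u, p_th],
             vector [0,           p_th,  r * u * e_th / th]]"

definition korteweg_B :: "real \<Rightarrow> real \<Rightarrow> real \<Rightarrow> real^3^3" where
  "korteweg_B th mu al = (1 / th) *\<^sub>R
     vector [vector [0, 0,  0],
             vector [0, mu, 0],
             vector [0, 0,  al / th]]"

definition korteweg_C :: "real \<Rightarrow> real \<Rightarrow> real \<Rightarrow> real^3^3" where
  "korteweg_C r th k = (1 / th) *\<^sub>R
     vector [vector [0,     0, 0],
             vector [k * r, 0, 0],
             vector [0,     0, 0]]"

end

(* The kernel of B(xi) consists of the vectors with vanishing second and third component.
   The entry of varrho A^0 + A(xi) in row 2 and column 1 is (p_r + xi^2 k r) / th for every
   varrho, because A^0 is diagonal, and it is positive. *)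
theory Submission
  imports Defs
begin

lemma d_x_plane_wave:
  fixes V :: "complex^'n"
  shows "d_x (\<lambda>y. exp (\<i> * of_real (\<xi> * y)) *s V)
    = (\<lambda>y. exp (\<i> * of_real (\<xi> * y)) *s ((\<i> * of_real \<xi>) *s V))"
proof
  fix x :: real
  \<comment> \<open>Real-linearity on the finite-dimensional space of complex numbers gives
    boundedness, so differentiating the vector wave reduces to its scalar factor.\<close>
  have "linear (\<lambda>z::complex. z *s V)"
    by (rule linearI) (auto simp: vec_eq_iff algebra_simps)
  then have lin: "bounded_linear (\<lambda>z::complex. z *s V)"
    by (simp add: linear_conv_bounded_linear)
  have "((\<lambda>y. exp (\<i> * of_real (\<xi> * y))) has_vector_derivative
      \<i> * of_real \<xi> * exp (\<i> * of_real (\<xi> * x))) (at x)"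
    \<comment> \<open>Splitting the product exhibits the phase as an entire function restricted to
      the real line, so its complex derivative yields the real one.\<close>
    unfolding of_real_mult
    by (rule has_vector_derivative_real_field) (auto intro!: derivative_eq_intros)
  from bounded_linear.has_vector_derivative[OF lin this]
  show "d_x (\<lambda>y. exp (\<i> * of_real (\<xi> * y)) *s V) x
      = exp (\<i> * of_real (\<xi> * x)) *s ((\<i> * of_real \<xi>) *s V)"
    by (simp add: d_x_def vector_derivative_at mult.commute)
qed

lemma d_x_funpow_plane_wave:
  fixes V :: "complex^'n"
  shows "(d_x ^^ n) (\<lambda>y. exp (\<i> * of_real (\<xi> * y)) *s V)
    = (\<lambda>y. exp (\<i> * of_real (\<xi> * y)) *s ((\<i> * of_real \<xi>) ^ n *s V))"
proof (induction n)
  case (Suc n)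
  then show ?case
    \<comment> \<open>The iterate is again a plane wave, of amplitude
      \<open>(\<i> * of_real \<xi>) ^ n *s V\<close>. Instantiating
      \<open>vector_smult_assoc\<close> keeps the exponential apart from the amplitude, so that
      \<open>d_x_plane_wave\<close> matches.\<close>
    by (simp only: funpow.simps o_apply d_x_plane_wave
        vector_smult_assoc[of "\<i> * of_real \<xi>"] power_Suc)
qed simp

lemma complexify_add: "complexify (M + N) = complexify M + complexify N"
  by (simp add: complexify_def vec_eq_iff)

lemma complexify_scaleR_mult_vec:
  "complexify (c *\<^sub>R M) *v V = of_real c *s (complexify M *v V)"
  by (simp add: complexify_def vec_eq_iff matrix_vector_mult_def sum_distrib_left mult.assoc)

text \<open>Each derivative contributes a factor i \<xi>. Since (i \<xi>)^2 = -\<xi>^2 and (i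
  \<xi>)^3 = -(i \<xi>) \<xi>^2, the third-order term joins \<open>A1\<close> in the odd part, while
  \<open>B\<close> alone forms the even part.\<close>

lemma has_symbols_korteweg_operator:
  fixes A1 B C :: "real^'n^'n"
  shows "has_symbols (korteweg_operator A1 B C) (\<lambda>\<xi>. A1 + \<xi>\<^sup>2 *\<^sub>R C) (\<lambda>\<xi>. \<xi>\<^sup>2 *\<^sub>R B)"
  unfolding has_symbols_def
proof (intro allI)
  fix \<xi> x :: real and V :: "complex^'n"
  show "korteweg_operator A1 B C (\<lambda>y. exp (\<i> * of_real (\<xi> * y)) *s V) x
      = exp (\<i> * of_real (\<xi> * x)) *s
        (- ((\<i> * of_real \<xi>) *s (complexify (A1 + \<xi>\<^sup>2 *\<^sub>R C) *v V) + complexify (\<xi>\<^sup>2 *\<^sub>R B) *v V))"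
    unfolding korteweg_operator_def d_x_plane_wave d_x_funpow_plane_wave complexify_add
      matrix_vector_mult_add_rdistrib complexify_scaleR_mult_vec vector_scalar_commute
    by (simp add: vec_eq_iff power2_eq_square power3_eq_cube algebra_simps)
qed

lemma genuinely_coupled_korteweg:
  fixes u p_th :: real
  assumes "r > 0" "th > 0" "p_r > 0" "mu > 0" "al > 0" "k > 0"
  shows "genuinely_coupled (\<lambda>\<xi>. korteweg_A0 r th p_r e_th)
    (\<lambda>\<xi>. korteweg_A1 r u th p_r p_th e_th + \<xi>\<^sup>2 *\<^sub>R korteweg_C r th k)
    (\<lambda>\<xi>. \<xi>\<^sup>2 *\<^sub>R korteweg_B th mu al)"
  unfolding genuinely_coupled_def
proof (intro allI impI notI, elim conjE)
  fix \<xi> \<rho> :: real and V :: "complex^3"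
  assume "\<xi> \<noteq> 0" and B: "complexify (\<xi>\<^sup>2 *\<^sub>R korteweg_B th mu al) *v V = 0" and "V \<noteq> 0"
    and A: "complexify (\<rho> *\<^sub>R korteweg_A0 r th p_r e_th
      + (korteweg_A1 r u th p_r p_th e_th + \<xi>\<^sup>2 *\<^sub>R korteweg_C r th k)) *v V = 0"
  \<comment> \<open>The matrix is diagonal, and its last two diagonal entries, \<xi>^2 mu / th and
    \<xi>^2 al / th^2, are nonzero.\<close>
  have V: "V $ 2 = 0" "V $ 3 = 0"
    using B assms \<open>\<xi> \<noteq> 0\<close>
    by (auto simp: vec_eq_iff forall_3 complexify_def matrix_vector_mult_def sum_3 korteweg_B_def)
  have "p_r / th + \<xi>\<^sup>2 * (k * r) / th > 0"
    using assms by (intro add_pos_nonneg) auto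
  \<comment> \<open>In row 2 the terms with \<open>\<rho>\<close>, \<open>u\<close> and
    \<open>p_th\<close> multiply \<open>V $ 2\<close> or \<open>V $ 3\<close> and vanish; only the
    column 1 entries of \<open>korteweg_A1\<close> and \<open>korteweg_C\<close> remain.\<close>
  moreover have "complex_of_real (p_r / th + \<xi>\<^sup>2 * (k * r) / th) * V $ 1 = 0"
    using arg_cong[OF A, of "\<lambda>W. W $ 2"] V
    by (simp add: complexify_def matrix_vector_mult_def sum_3
        korteweg_A0_def korteweg_A1_def korteweg_C_def)
  ultimately have "V $ 1 = 0"
    by (metis mult_eq_0_iff of_real_eq_0_iff less_irrefl)
  with V \<open>V \<noteq> 0\<close> show False
    by (auto simp: vec_eq_iff forall_3)
qed

theorem corollary4p11:
  fixes r u th p_r p_th e_th mu al k :: real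
    and A0 A1 B C :: "real^3^3"
  assumes "r > 0" "th > 0" "p_r > 0" "p_th > 0" "e_th > 0" "mu > 0" "al > 0" "k > 0"
    and "A0 = korteweg_A0 r th p_r e_th"
    and "A1 = korteweg_A1 r u th p_r p_th e_th"
    and "B = korteweg_B th mu al"
    and "C = korteweg_C r th k"
  shows "genuine_coupling_condition (\<lambda>\<xi>. A0) (korteweg_operator A1 B C)
    \<and> has_symbols (korteweg_operator A1 B C) (\<lambda>\<xi>. A1 + \<xi>\<^sup>2 *\<^sub>R C) (\<lambda>\<xi>. \<xi>\<^sup>2 *\<^sub>R B)
    \<and> genuinely_coupled (\<lambda>\<xi>. A0) (\<lambda>\<xi>. A1 + \<xi>\<^sup>2 *\<^sub>R C) (\<lambda>\<xi>. \<xi>\<^sup>2 *\<^sub>R B)"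
proof -
  have "has_symbols (korteweg_operator A1 B C) (\<lambda>\<xi>. A1 + \<xi>\<^sup>2 *\<^sub>R C) (\<lambda>\<xi>. \<xi>\<^sup>2 *\<^sub>R B)"
    by (rule has_symbols_korteweg_operator)
  moreover have "genuinely_coupled (\<lambda>\<xi>. A0) (\<lambda>\<xi>. A1 + \<xi>\<^sup>2 *\<^sub>R C) (\<lambda>\<xi>. \<xi>\<^sup>2 *\<^sub>R B)"
    using assms by (simp only: genuinely_coupled_korteweg)
  ultimately show ?thesis
    unfolding genuine_coupling_condition_def by blast
qed

end
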